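(* Let $$G_1=\left\langle t_i\ (i\ge1)\ \middle|\ t_i^2=I,\ \ t_it_j=t_jt_i \text{ if } |i-j|>1\right\rangle$$ and $$G_2=\left\langle q_{[i,j]}\ (1\le i<j)\ \middle|\ q_{[i,j]}^2=I,\ \ q_{[i,j]}q_{[k,l]}q_{[i,j]}=q_{[i+j-l,\,i+j-k]}\text{ if } i\le k<l\le j\right\rangle .$$ Then $G_1\cong G_2$. More precisely, consider the homomorphism from the free group on the $q_{[i,j]}$ to the free group on the $t_i$ given by $$q_{[i,j]}\mapsto q_{j-1}q_{j-i}q_{j-1},\qquad q_m:=t_1(t_2t_1)\cdots(t_mt_{m-1}\cdots t_1),$$ and the homomorphism from the free group on the $t_i$ to the free group on the $q_{[i,j]}$ given by $$t_1\mapsto q_{[1,2]},\quad t_2\mapsto q_{[1,2]}q_{[1,3]}q_{[1,2]},\quad t_i\mapsto q_{[1,i]}q_{[1,i+1]}q_{[1,i]}q_{[1,i-1]}\ \text{ for } i>2 .$$ These homomorphisms descend to mutually inverse isomorphisms between $G_2$ and $G_1$.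
   Context: All indices are positive integers; $I$ denotes the identity element. The groups $G_1$ and $G_2$ are abstract groups given by the displayed presentations, with infinitely many generators. *)

theory Defs
  imports "HOL-Algebra.Algebra"
begin

section \<open>Free groups as groups of reduced words\<close>

text \<open>The letter \<open>(x, True)\<close> stands for the generator \<open>x\<close>, and \<open>(x, False)\<close> for its
  formal inverse.\<close>

type_synonym 'a letter = "'a \<times> bool"
type_synonym 'a word = "'a letter list"

definition letter_inv :: "'a letter \<Rightarrow> 'a letter" where
  "letter_inv a = (fst a, \<not> snd a)"

definition reduced :: "'a word \<Rightarrow> bool" where
  "reduced w \<longleftrightarrow> successively (\<lambda>a b. b \<noteq> letter_inv a) w"

fun cancel_cons :: "'a letter \<Rightarrow> 'a word \<Rightarrow> 'a word" where
  "cancel_cons a [] = [a]"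
| "cancel_cons a (b # w) = (if b = letter_inv a then w else a # b # w)"

definition reduce :: "'a word \<Rightarrow> 'a word" where
  "reduce w = foldr cancel_cons w []"

definition free_group :: "'a set \<Rightarrow> 'a word monoid" where
  "free_group S = \<lparr>carrier = {w. fst ` set w \<subseteq> S \<and> reduced w},
                   monoid.mult = (\<lambda>u v. reduce (u @ v)), one = []\<rparr>"

definition gen :: "'a \<Rightarrow> 'a word" where
  "gen x = [(x, True)]"

text \<open>The homomorphism out of a free group with prescribed values on the generators;
  see \<open>free_lift_hom\<close>, \<open>free_lift_gen\<close> and \<open>free_lift_unique\<close>.\<close>

definition free_lift :: "('b, 'c) monoid_scheme \<Rightarrow> ('a \<Rightarrow> 'b) \<Rightarrow> 'a word \<Rightarrow> 'b" where
  "free_lift G f w =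
     foldr (\<lambda>a y. (if snd a then f (fst a) else inv\<^bsub>G\<^esub> (f (fst a))) \<otimes>\<^bsub>G\<^esub> y) w \<one>\<^bsub>G\<^esub>"

lemma letter_inv_invol [simp]: "letter_inv (letter_inv a) = a"
  by (simp add: letter_inv_def)

lemma fst_letter_inv [simp]: "fst (letter_inv a) = fst a"
  by (simp add: letter_inv_def)

lemma reduced_Nil [simp]: "reduced []"
  by (simp add: reduced_def)

lemma reduced_Cons: "reduced (a # w) \<longleftrightarrow> reduced w \<and> (w = [] \<or> hd w \<noteq> letter_inv a)"
  by (auto simp: reduced_def successively_Cons)

lemma reduced_cancel_cons: "reduced w \<Longrightarrow> reduced (cancel_cons a w)"
  by (cases w) (auto simp: reduced_Cons)

lemma reduced_foldr: "reduced w \<Longrightarrow> reduced (foldr cancel_cons u w)"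
  by (induction u) (auto intro: reduced_cancel_cons)

lemma letters_cancel_cons: "fst ` set (cancel_cons a w) \<subseteq> insert (fst a) (fst ` set w)"
  by (cases w) auto

lemma letters_foldr: "fst ` set (foldr cancel_cons u w) \<subseteq> fst ` set u \<union> fst ` set w"
proof (induction u)
  case (Cons a u)
  then show ?case using letters_cancel_cons[of a "foldr cancel_cons u w"] by simp blast
qed simp

lemma cancel_cons_inv: "reduced w \<Longrightarrow> cancel_cons a (cancel_cons (letter_inv a) w) = w"
proof (cases w)
  case (Cons b v)
  assume "reduced w"
  then show ?thesis using Cons by (cases v) (auto simp: reduced_Cons)
qed simp

lemma foldr_cancel_cons:
  "reduced w \<Longrightarrow> foldr cancel_cons (cancel_cons a u) w = cancel_cons a (foldr cancel_cons u w)"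
  by (cases u) (auto simp: cancel_cons_inv reduced_foldr)

lemma foldr_reduce:
  "reduced w \<Longrightarrow> foldr cancel_cons (foldr cancel_cons u v) w = foldr cancel_cons u (foldr cancel_cons v w)"
  by (induction u) (auto simp: foldr_cancel_cons)

lemma reduce_reduced: "reduced w \<Longrightarrow> reduce w = w"
  unfolding reduce_def
proof (induction w)
  case (Cons a w)
  then have "foldr cancel_cons w [] = w" by (simp add: reduced_Cons)
  then show ?case using Cons.prems by (cases w) (auto simp: reduced_Cons)
qed simp

lemma free_group_mult:
  "v \<in> carrier (free_group S) \<Longrightarrow> u \<otimes>\<^bsub>free_group S\<^esub> v = foldr cancel_cons u v"
  using reduce_reduced[of v] by (simp add: free_group_def reduce_def)

lemma free_group_one: "\<one>\<^bsub>free_group S\<^esub> = []"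
  by (simp add: free_group_def)

lemma free_group_mult_closed:
  assumes "u \<in> carrier (free_group S)" "v \<in> carrier (free_group S)"
  shows "foldr cancel_cons u v \<in> carrier (free_group S)"
  using assms subset_trans[OF letters_foldr[of u v], of S] reduced_foldr[of v u]
  by (simp add: free_group_def)

lemma free_group_left_inv:
  assumes "w \<in> carrier (free_group S)"
  shows "\<exists>v\<in>carrier (free_group S). v \<otimes>\<^bsub>free_group S\<^esub> w = \<one>\<^bsub>free_group S\<^esub>"
  using assms
proof (induction w)
  case Nil
  show ?case by (rule bexI[of _ "[]"]) (simp_all add: free_group_def reduce_def)
next
  case (Cons a w)
  have w: "w \<in> carrier (free_group S)" and a: "[letter_inv a] \<in> carrier (free_group S)"
    using Cons.prems by (auto simp: free_group_def reduced_Cons)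
  obtain v where v: "v \<in> carrier (free_group S)" "foldr cancel_cons v w = []"
    using Cons.IH[OF w] free_group_mult[OF w] by (auto simp: free_group_one)
  have red: "reduced (a # w)"
    using Cons.prems by (simp add: free_group_def)
  let ?v = "foldr cancel_cons v [letter_inv a]"
  have "foldr cancel_cons ?v (a # w) = foldr cancel_cons v w"
    using foldr_reduce[OF red, of v "[letter_inv a]"] by simp
  then show ?case
    using free_group_mult_closed[OF v(1) a] v(2) free_group_mult[OF Cons.prems]
    by (auto simp: free_group_one)
qed

lemma free_group_is_group: "group (free_group S)"
proof (rule groupI)
  fix x y z
  assume xyz: "x \<in> carrier (free_group S)" "y \<in> carrier (free_group S)" "z \<in> carrier (free_group S)"
  then have "reduced z" by (simp add: free_group_def)
  with xyz show "x \<otimes>\<^bsub>free_group S\<^esub> y \<otimes>\<^bsub>free_group S\<^esub> z = x \<otimes>\<^bsub>free_group S\<^esub> (y \<otimes>\<^bsub>free_group S\<^esub> z)"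
    by (simp add: free_group_mult free_group_mult_closed foldr_reduce)
next
  fix x
  assume "x \<in> carrier (free_group S)"
  then show "\<one>\<^bsub>free_group S\<^esub> \<otimes>\<^bsub>free_group S\<^esub> x = x"
    by (simp add: free_group_mult free_group_one)
next
  show "\<one>\<^bsub>free_group S\<^esub> \<in> carrier (free_group S)"
    by (simp add: free_group_def)
qed (simp add: free_group_mult free_group_mult_closed, rule free_group_left_inv)

lemma gen_closed: "x \<in> S \<Longrightarrow> gen x \<in> carrier (free_group S)"
  by (simp add: gen_def free_group_def reduced_Cons)

context group
begin

lemma free_lift_closed:
  "f \<in> S \<rightarrow> carrier G \<Longrightarrow> fst ` set w \<subseteq> S \<Longrightarrow> free_lift G f w \<in> carrier G"
  by (induction w) (auto simp: free_lift_def)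

lemma free_lift_cancel_cons:
  assumes "f \<in> S \<rightarrow> carrier G" "fst a \<in> S" "fst ` set w \<subseteq> S"
  shows "free_lift G f (cancel_cons a w) = free_lift G f (a # w)"
proof (cases w)
  case (Cons b v)
  have "f (fst a) \<in> carrier G" "free_lift G f v \<in> carrier G"
    using assms Cons by (auto intro: free_lift_closed)
  then show ?thesis
    using Cons by (auto simp: free_lift_def letter_inv_def m_assoc[symmetric])
qed simp

lemma free_lift_foldr:
  assumes "f \<in> S \<rightarrow> carrier G" "fst ` set u \<subseteq> S" "fst ` set v \<subseteq> S"
  shows "free_lift G f (foldr cancel_cons u v) = free_lift G f u \<otimes> free_lift G f v"
  using assms(2)
proof (induction u)
  case Nil
  then show ?case using free_lift_closed[OF assms(1,3)] by (simp add: free_lift_def)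
next
  case (Cons a u)
  have sub: "fst ` set (foldr cancel_cons u v) \<subseteq> S"
    using letters_foldr[of u v] Cons.prems assms(3) by simp blast
  have cl: "f (fst a) \<in> carrier G" "free_lift G f u \<in> carrier G" "free_lift G f v \<in> carrier G"
    using assms Cons.prems by (auto intro: free_lift_closed)
  have step: "free_lift G f (a # w) =
      (if snd a then f (fst a) else inv (f (fst a))) \<otimes> free_lift G f w" for w
    by (simp add: free_lift_def)
  have "free_lift G f (foldr cancel_cons (a # u) v) = free_lift G f (a # foldr cancel_cons u v)"
    using free_lift_cancel_cons[OF assms(1) _ sub, of a] Cons.prems by simp
  then show ?case
    using Cons cl by (simp add: step m_assoc)
qed

lemma free_lift_hom:
  assumes "f \<in> S \<rightarrow> carrier G"
  shows "free_lift G f \<in> hom (free_group S) G"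
proof (rule homI)
  fix x y assume "x \<in> carrier (free_group S)" "y \<in> carrier (free_group S)"
  then show "free_lift G f (x \<otimes>\<^bsub>free_group S\<^esub> y) = free_lift G f x \<otimes> free_lift G f y"
    using free_lift_foldr[OF assms, of x y] by (simp add: free_group_mult) (simp add: free_group_def)
qed (use assms in \<open>auto simp: free_group_def intro: free_lift_closed\<close>)

lemma free_lift_gen:
  "f x \<in> carrier G \<Longrightarrow> free_lift G f (gen x) = f x"
  by (simp add: free_lift_def gen_def)

lemma free_lift_unique:
  assumes h: "h \<in> hom (free_group S) G" and hf: "\<And>x. x \<in> S \<Longrightarrow> h (gen x) = f x"
    and w: "w \<in> carrier (free_group S)"
  shows "h w = free_lift G f w"
proof -
  interpret F: group "free_group S" by (rule free_group_is_group)
  interpret h: group_hom "free_group S" G h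
    using h by unfold_locales
  show ?thesis
    using w
  proof (induction w)
    case Nil
    then show ?case using h.hom_one by (simp add: free_lift_def free_group_one)
  next
    case (Cons a w)
    have w: "w \<in> carrier (free_group S)" and a: "[a] \<in> carrier (free_group S)" "fst a \<in> S"
      using Cons.prems by (auto simp: free_group_def reduced_Cons)
    have split: "a # w = [a] \<otimes>\<^bsub>free_group S\<^esub> w"
      using Cons.prems reduce_reduced[of "a # w"] by (simp add: free_group_def)
    have "h [a] = (if snd a then f (fst a) else inv (f (fst a)))"
    proof (cases "snd a")
      case True
      then show ?thesis using hf[OF a(2)] by (cases a) (simp add: gen_def)
    next
      case False
      have "[a] \<otimes>\<^bsub>free_group S\<^esub> gen (fst a) = \<one>\<^bsub>free_group S\<^esub>"
        using False by (cases a) (simp add: free_group_def reduce_def gen_def letter_inv_def)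
      then have "[a] = inv\<^bsub>free_group S\<^esub> gen (fst a)"
        using F.inv_equality a gen_closed[OF a(2)] by simp
      then show ?thesis using False hf[OF a(2)] h.hom_inv[OF gen_closed[OF a(2)]] by simp
    qed
    then show ?case
      using h.hom_mult[OF a(1) w] Cons.IH[OF w] unfolding split[symmetric]
      by (simp add: free_lift_def)
  qed
qed

end


section \<open>Presentations\<close>

definition normal_closure :: "('a, 'b) monoid_scheme \<Rightarrow> 'a set \<Rightarrow> 'a set" where
  "normal_closure G R = \<Inter>{N. N \<lhd> G \<and> R \<subseteq> N}"

text \<open>A pair \<open>(u, v)\<close> encodes the relation \<open>u = v\<close>.\<close>

definition relator_closure :: "'a set \<Rightarrow> ('a word \<times> 'a word) set \<Rightarrow> 'a word set" where
  "relator_closure S E =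
     normal_closure (free_group S) ((\<lambda>(u, v). u \<otimes>\<^bsub>free_group S\<^esub> inv\<^bsub>free_group S\<^esub> v) ` E)"

definition presented_group :: "'a set \<Rightarrow> ('a word \<times> 'a word) set \<Rightarrow> 'a word set monoid" where
  "presented_group S E = free_group S Mod relator_closure S E"


section \<open>The two groups and the two homomorphisms\<close>

definition St :: "nat set" where
  "St = {i. 1 \<le> i}"

definition Sq :: "(nat \<times> nat) set" where
  "Sq = {(i, j). 1 \<le> i \<and> i < j}"

abbreviation Ft :: "nat word monoid" where "Ft \<equiv> free_group St"
abbreviation Fq :: "(nat \<times> nat) word monoid" where "Fq \<equiv> free_group Sq"

abbreviation t :: "nat \<Rightarrow> nat word" where "t i \<equiv> gen i"
abbreviation q :: "nat \<Rightarrow> nat \<Rightarrow> (nat \<times> nat) word" where "q i j \<equiv> gen (i, j)"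

definition E1 :: "(nat word \<times> nat word) set" where
  "E1 = {(t i \<otimes>\<^bsub>Ft\<^esub> t i, \<one>\<^bsub>Ft\<^esub>) | i. 1 \<le> i}
      \<union> {(t i \<otimes>\<^bsub>Ft\<^esub> t j, t j \<otimes>\<^bsub>Ft\<^esub> t i) | i j. 1 \<le> i \<and> 1 \<le> j \<and> \<bar>int i - int j\<bar> > 1}"

text \<open>The truncated subtractions are harmless, as \<open>k < l \<le> j\<close>.\<close>

definition E2 :: "((nat \<times> nat) word \<times> (nat \<times> nat) word) set" where
  "E2 = {(q i j \<otimes>\<^bsub>Fq\<^esub> q i j, \<one>\<^bsub>Fq\<^esub>) | i j. 1 \<le> i \<and> i < j}
      \<union> {(q i j \<otimes>\<^bsub>Fq\<^esub> q k l \<otimes>\<^bsub>Fq\<^esub> q i j, q (i + j - l) (i + j - k)) | i j k l.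
           1 \<le> i \<and> i \<le> k \<and> k < l \<and> l \<le> j}"

definition G1 :: "nat word set monoid" where
  "G1 = presented_group St E1"

definition G2 :: "(nat \<times> nat) word set monoid" where
  "G2 = presented_group Sq E2"

fun t_desc :: "nat \<Rightarrow> nat word" where  \<comment> \<open>\<open>t\<^sub>m t\<^sub>m\<^sub>-\<^sub>1 \<cdots> t\<^sub>1\<close>\<close>
  "t_desc 0 = \<one>\<^bsub>Ft\<^esub>"
| "t_desc (Suc m) = t (Suc m) \<otimes>\<^bsub>Ft\<^esub> t_desc m"

fun qt :: "nat \<Rightarrow> nat word" where  \<comment> \<open>\<open>q\<^sub>m = t\<^sub>1 (t\<^sub>2 t\<^sub>1) \<cdots> (t\<^sub>m t\<^sub>m\<^sub>-\<^sub>1 \<cdots> t\<^sub>1)\<close>\<close>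
  "qt 0 = \<one>\<^bsub>Ft\<^esub>"
| "qt (Suc m) = qt m \<otimes>\<^bsub>Ft\<^esub> t_desc (Suc m)"

definition phi :: "(nat \<times> nat) word \<Rightarrow> nat word" where
  "phi = free_lift Ft (\<lambda>(i, j). qt (j - 1) \<otimes>\<^bsub>Ft\<^esub> qt (j - i) \<otimes>\<^bsub>Ft\<^esub> qt (j - 1))"

definition psi :: "nat word \<Rightarrow> (nat \<times> nat) word" where
  "psi = free_lift Fq (\<lambda>i.
     if i = 1 then q 1 2
     else if i = 2 then q 1 2 \<otimes>\<^bsub>Fq\<^esub> q 1 3 \<otimes>\<^bsub>Fq\<^esub> q 1 2
     else q 1 i \<otimes>\<^bsub>Fq\<^esub> q 1 (i + 1) \<otimes>\<^bsub>Fq\<^esub> q 1 i \<otimes>\<^bsub>Fq\<^esub> q 1 (i - 1))"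

text \<open>The map \<open>\<Phi>\<close> on cosets is induced by the map \<open>f\<close>.\<close>

definition induced_by ::
  "('a, 'c) monoid_scheme \<Rightarrow> 'a set \<Rightarrow> ('b, 'd) monoid_scheme \<Rightarrow> 'b set
    \<Rightarrow> ('a \<Rightarrow> 'b) \<Rightarrow> ('a set \<Rightarrow> 'b set) \<Rightarrow> bool" where
  "induced_by F N F' N' f \<Phi> \<longleftrightarrow> (\<forall>w\<in>carrier F. \<Phi> (N #>\<^bsub>F\<^esub> w) = N' #>\<^bsub>F'\<^esub> f w)"

end

theory Submission
  imports Defs
begin

text \<open>By the relations with \<open>i = k = 1\<close>, the group \<open>G2\<close> is generated by the involutions
  \<open>x m = q\<^bsub>[1,m+1]\<^esub>\<close>, and all its relations follow from
  \<open>x a x b x c x b x a = x e x c x e\<close> for \<open>c \<le> b \<le> a\<close> and \<open>e = a - b + c\<close>.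
  Equivalently, \<open>x b x a x e\<close> commutes with \<open>x c\<close>. In \<open>G1\<close>, commutation alone gives
  \<open>q\<^sub>b q\<^sub>a q\<^sub>e = q\<^sub>c z\<close>, where \<open>z\<close> is a product of \<open>t\<^sub>i\<close> with \<open>i \<ge> c + 2\<close>; such a \<open>z\<close> commutes
  with \<open>q\<^sub>c\<close>, so the \<open>q\<^sub>m\<close> satisfy the relations of the \<open>x m\<close>. Conversely, conjugating intervals
  one reversal at a time shows that \<open>x (i - 1) x i x (i - 1) x (i - 2)\<close> commutes with \<open>x c\<close> for
  \<open>c \<le> i - 2\<close>, which yields the relations of \<open>G1\<close>. The two substitutions
  are mutually inverse because the products telescope.\<close>

section \<open>Groups with reversals of initial segments\<close>

lemma (in group) involution_cancel:
  assumes "x \<in> carrier G" "y \<in> carrier G" "x \<otimes> x = \<one>"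
  shows "x \<otimes> (x \<otimes> y) = y"
  using assms by (simp flip: m_assoc)

lemma (in group) commute_mult:
  assumes "x \<in> carrier G" "y \<in> carrier G" "z \<in> carrier G"
    and "x \<otimes> y = y \<otimes> x" "x \<otimes> z = z \<otimes> x"
  shows "x \<otimes> (y \<otimes> z) = (y \<otimes> z) \<otimes> x"
  using assms by (metis m_assoc)

text \<open>The element \<open>x m\<close> plays the role of the reversal \<open>q\<^bsub>[1,m+1]\<^esub>\<close>; the value \<open>x 0 = \<one>\<close> makes the
  boundary cases of all formulas uniform.\<close>

locale prefix_reversals = group G for G (structure) +
  fixes x :: "nat \<Rightarrow> 'a"
  assumes x_closed [simp]: "x m \<in> carrier G"
    and x_0: "x 0 = \<one>"
    and x_square: "x m \<otimes> x m = \<one>"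
    and x_conj: "c \<le> b \<Longrightarrow> b \<le> a \<Longrightarrow>
      x a \<otimes> (x b \<otimes> (x c \<otimes> (x b \<otimes> x a))) = x (a - b + c) \<otimes> (x c \<otimes> x (a - b + c))"
begin

lemma x_cancel: "y \<in> carrier G \<Longrightarrow> x m \<otimes> (x m \<otimes> y) = y"
  by (simp add: involution_cancel x_square)

text \<open>The form of \<open>phi\<close>: \<open>q_[1,j] q_[1,j-i+1] q_[1,j]\<close>, which the
  conjugation relation with \<open>i = k = 1\<close> identifies with \<open>q_[i,j]\<close>.\<close>

definition reversal :: "nat \<Rightarrow> nat \<Rightarrow> 'a" where
  "reversal i j = x (j - 1) \<otimes> (x (j - i) \<otimes> x (j - 1))"

text \<open>Covers all three clauses of \<open>psi\<close>: truncated subtraction and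
  \<open>x 0 = \<one>\<close> reduce it to \<open>x 1\<close> at \<open>i = 1\<close> and to
  \<open>x 1 x 2 x 1\<close> at \<open>i = 2\<close>.\<close>

definition switch :: "nat \<Rightarrow> 'a" where
  "switch i = x (i - 1) \<otimes> (x i \<otimes> (x (i - 1) \<otimes> x (i - 2)))"

lemma reversal_closed [simp]: "reversal i j \<in> carrier G"
  by (simp add: reversal_def)

lemma switch_closed [simp]: "switch i \<in> carrier G"
  by (simp add: switch_def)

lemma reversal_1: "reversal 1 (Suc m) = x m"
  by (simp add: reversal_def x_cancel x_square)

lemma reversal_square: "reversal i j \<otimes> reversal i j = \<one>"
  by (simp add: reversal_def m_assoc x_cancel x_square)

text \<open>This is \<open>x_conj\<close> with \<open>b = l - 1\<close> and
  \<open>c = l - k\<close>: conjugation by \<open>x a\<close> reflects intervals inside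
  \<open>[1, a+1]\<close>. In this form \<open>x a\<close> can be moved through products. For
  \<open>k = l\<close> the reversal is \<open>\<one>\<close>.\<close>

lemma x_reversal:
  assumes "1 \<le> k" "k \<le> l" "l \<le> a + 1"
  shows "x a \<otimes> reversal k l = reversal (a + 2 - l) (a + 2 - k) \<otimes> x a"
proof -
  have e: "a - (l - 1) + (l - k) = a + 1 - k" "a + 2 - k - 1 = a + 1 - k"
    "a + 2 - k - (a + 2 - l) = l - k"
    using assms by auto
  have "x a \<otimes> (reversal k l \<otimes> x a) = reversal (a + 2 - l) (a + 2 - k)"
    using x_conj[of "l - k" "l - 1" a] assms by (simp only: reversal_def e) (simp add: m_assoc)
  then have "x a \<otimes> (reversal k l \<otimes> x a) \<otimes> x a = reversal (a + 2 - l) (a + 2 - k) \<otimes> x a"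
    by simp
  then show ?thesis
    by (simp add: m_assoc x_square)
qed

lemma x_reversal_left:
  assumes "1 \<le> k" "k \<le> l" "l \<le> a + 1" "y \<in> carrier G"
  shows "x a \<otimes> (reversal k l \<otimes> y) = reversal (a + 2 - l) (a + 2 - k) \<otimes> (x a \<otimes> y)"
  using x_reversal[OF assms(1-3)] assms(4) by (metis m_assoc reversal_closed x_closed)

text \<open>The three factors of \<open>reversal i j\<close> reflect \<open>[k, l]\<close> in turn
  to \<open>[j+1-l, j+1-k]\<close>, \<open>[k+1-i, l+1-i]\<close> and
  \<open>[i+j-l, i+j-k]\<close>.\<close>

lemma reversal_conj:
  assumes "1 \<le> i" "i \<le> k" "k < l" "l \<le> j"
  shows "reversal i j \<otimes> reversal k l \<otimes> reversal i j = reversal (i + j - l) (i + j - k)"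
proof -
  have 1: "x (j - 1) \<otimes> (reversal k l \<otimes> y) = reversal (j + 1 - l) (j + 1 - k) \<otimes> (x (j - 1) \<otimes> y)"
    if "y \<in> carrier G" for y
    using x_reversal_left[of k l "j - 1" y] assms that
    by (simp add: numeral_2_eq_2 Suc_diff_Suc)
  have 2: "x (j - i) \<otimes> (reversal (j + 1 - l) (j + 1 - k) \<otimes> y)
      = reversal (k + 1 - i) (l + 1 - i) \<otimes> (x (j - i) \<otimes> y)"
    if "y \<in> carrier G" for y
  proof -
    have e: "j - i + 2 - (j + 1 - k) = k + 1 - i" "j - i + 2 - (j + 1 - l) = l + 1 - i"
      using assms by auto
    show ?thesis
      using x_reversal_left[of "j + 1 - l" "j + 1 - k" "j - i" y] assms that
      by (simp add: e add.commute)
  qed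
  have 3: "x (j - 1) \<otimes> (reversal (k + 1 - i) (l + 1 - i) \<otimes> y)
      = reversal (i + j - l) (i + j - k) \<otimes> (x (j - 1) \<otimes> y)"
    if "y \<in> carrier G" for y
  proof -
    have e: "j - 1 + 2 - (k + 1 - i) = i + j - k" "j - 1 + 2 - (l + 1 - i) = i + j - l"
      using assms by auto
    show ?thesis
      using x_reversal_left[of "k + 1 - i" "l + 1 - i" "j - 1" y] assms that
      by (simp add: e add.commute)
  qed
  have "reversal i j \<otimes> reversal k l \<otimes> reversal i j
      = reversal (i + j - l) (i + j - k) \<otimes> (reversal i j \<otimes> reversal i j)"
    unfolding reversal_def[of i j] by (simp add: m_assoc 1 2 3 del: One_nat_def)
  then show ?thesis
    by (simp add: reversal_square)
qed

text \<open>As \<open>x c\<close> reverses \<open>[1, c+1]\<close>, it suffices to follow this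
  interval through the four factors from the right: it becomes \<open>[m+1-c, m+1]\<close>,
  \<open>[2, c+2]\<close>, \<open>[m+2-c, m+2]\<close> and again \<open>[1, c+1]\<close>.\<close>

lemma switch_x_commute:
  assumes "c \<le> m"
  shows "switch (m + 2) \<otimes> x c = x c \<otimes> switch (m + 2)"
proof -
  let ?r = "reversal 1 (c + 1)"
  have "x m \<otimes> ?r = reversal (m + 1 - c) (m + 1) \<otimes> x m"
    using x_reversal[of 1 "c + 1" m] assms by simp
  moreover have "x (m + 1) \<otimes> (reversal (m + 1 - c) (m + 1) \<otimes> y)
      = reversal 2 (c + 2) \<otimes> (x (m + 1) \<otimes> y)" if "y \<in> carrier G" for y
  proof -
    have "m + 1 + 2 - (m + 1) = 2" "m + 1 + 2 - (m + 1 - c) = c + 2"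
      using assms by auto
    then show ?thesis
      using x_reversal_left[of "m + 1 - c" "m + 1" "m + 1" y] assms that by simp
  qed
  moreover have "x (m + 2) \<otimes> (reversal 2 (c + 2) \<otimes> y)
      = reversal (m + 2 - c) (m + 2) \<otimes> (x (m + 2) \<otimes> y)" if "y \<in> carrier G" for y
    using x_reversal_left[of 2 "c + 2" "m + 2" y] assms that by simp
  moreover have "x (m + 1) \<otimes> (reversal (m + 2 - c) (m + 2) \<otimes> y)
      = ?r \<otimes> (x (m + 1) \<otimes> y)" if "y \<in> carrier G" for y
  proof -
    have "m + 1 + 2 - (m + 2) = 1" "m + 1 + 2 - (m + 2 - c) = c + 1"
      using assms by auto
    then show ?thesis
      using x_reversal_left[of "m + 2 - c" "m + 2" "m + 1" y] assms that by simp
  qed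
  ultimately have "switch (m + 2) \<otimes> ?r = ?r \<otimes> switch (m + 2)"
    unfolding switch_def by (simp add: m_assoc)
  then show ?thesis
    using reversal_1[of c] by simp
qed

lemma switch_square: "switch i \<otimes> switch i = \<one>"
proof -
  consider "i = 0" | "i = 1" | m where "i = m + 2"
    by (metis One_nat_def add_2_eq_Suc' less_2_cases not_less le_Suc_ex add.commute)
  then show ?thesis
  proof cases
    case 3
    \<comment> \<open>\<open>?y\<close> is a conjugate of an involution, and \<open>?y x m\<close>
      commutes with \<open>x m\<close>; so the square of the switch is that of
      \<open>?y\<close>.\<close>
    let ?y = "x (m + 1) \<otimes> (x (m + 2) \<otimes> x (m + 1))"
    have s: "switch i = ?y \<otimes> x m"
      using 3 by (simp add: switch_def m_assoc)
    have "x m \<otimes> switch i = ?y"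
      using switch_x_commute[of m m] 3 s by (simp add: m_assoc x_square)
    then have "switch i \<otimes> switch i = ?y \<otimes> ?y"
      by (subst s) (simp add: m_assoc)
    then show ?thesis
      by (simp add: m_assoc x_cancel x_square)
  qed (simp_all add: switch_def x_0 x_square)
qed

text \<open>\<open>switch i\<close> is a word in the \<open>x c\<close> with
  \<open>c \<le> i \<le> j - 2\<close>, and \<open>switch j\<close> commutes with each of
  these.\<close>

lemma switch_commute:
  assumes "Suc i < j"
  shows "switch i \<otimes> switch j = switch j \<otimes> switch i"
proof -
  obtain m where m: "j = m + 2" "i \<le> m"
    using assms by (metis add_2_eq_Suc' less_iff_Suc_add le_add1 add_Suc_right add_Suc)
  have "switch j \<otimes> x c = x c \<otimes> switch j" if "c \<le> i" for c
    using switch_x_commute[of c m] m that by simp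
  then have "switch j \<otimes> switch i = switch i \<otimes> switch j"
    unfolding switch_def[of i] by (intro commute_mult) auto
  then show ?thesis by simp
qed

end

section \<open>Products of commuting involutions\<close>

text \<open>The relations of \<open>G1\<close> in abstract form, to be used both for the
  \<open>t_i\<close> in \<open>G1\<close> and for the switches in \<open>G2\<close>. Index 0 carries
  the identity in both cases.\<close>

locale commuting_involutions = group G for G (structure) +
  fixes s :: "nat \<Rightarrow> 'a"
  assumes s_closed [simp]: "s i \<in> carrier G"
    and s_square: "s i \<otimes> s i = \<one>"
    and s_commute: "Suc i < j \<Longrightarrow> s i \<otimes> s j = s j \<otimes> s i"
begin

fun desc :: "nat \<Rightarrow> nat \<Rightarrow> 'a" where
  "desc m 0 = \<one>"
| "desc m (Suc n) = s (m + Suc n) \<otimes> desc m n"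

fun triangle :: "nat \<Rightarrow> 'a" where
  "triangle 0 = \<one>"
| "triangle (Suc m) = triangle m \<otimes> desc 0 (Suc m)"

text \<open>The rows \<open>desc 1 n\<close> to \<open>desc c n\<close> of a parallelogram: runs of
  equal length \<open>n\<close>, each shifted up by one.\<close>

fun strip :: "nat \<Rightarrow> nat \<Rightarrow> 'a" where
  "strip n 0 = \<one>"
| "strip n (Suc c) = strip n c \<otimes> desc (Suc c) n"

lemma desc_closed [simp]: "desc m n \<in> carrier G"
  by (induction n) auto

lemma triangle_closed [simp]: "triangle m \<in> carrier G"
  by (induction m) auto

lemma strip_closed [simp]: "strip n c \<in> carrier G"
  by (induction c) auto

text \<open>All indices in \<open>desc m n\<close> are at least \<open>m + 1\<close>, hence at least
  \<open>i + 2\<close>.\<close>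

lemma s_desc_commute: "i < m \<Longrightarrow> s i \<otimes> desc m n = desc m n \<otimes> s i"
  by (induction n) (auto intro!: commute_mult s_commute simp del: One_nat_def)

lemma desc_commute:
  assumes "n < m"
  shows "desc m k \<otimes> desc 0 n = desc 0 n \<otimes> desc m k"
  using assms
proof (induction n)
  case (Suc n)
  then show ?case
    using s_desc_commute[of "Suc n" m k] by (auto intro!: commute_mult)
qed simp

lemma triangle_desc_commute:
  assumes "c < m"
  shows "desc m n \<otimes> triangle c = triangle c \<otimes> desc m n"
  using assms
proof (induction c)
  case (Suc c)
  then show ?case
    using desc_commute[of "Suc c" m n] by (simp del: desc.simps add: commute_mult)
qed simp

text \<open>Commutation alone rearranges the triangle of size \<open>c + n\<close>: cut off the triangles in two of
  its corners; what remains is a parallelogram.\<close>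

lemma triangle_split: "triangle (c + n) = triangle n \<otimes> (strip n c \<otimes> triangle c)"
proof (induction c)
  case (Suc c)
  \<comment> \<open>The new run is cut above index \<open>Suc c\<close>. Its upper piece has indices
    at least \<open>c + 2\<close>, so it passes \<open>triangle c\<close> and extends the strip; the
    lower piece completes \<open>triangle (Suc c)\<close>.\<close>
  have split: "desc 0 (Suc c + n) = desc (Suc c) n \<otimes> desc 0 (Suc c)" for c
    by (induction n) (simp_all add: m_assoc add.commute)
  have "triangle (Suc c + n) = triangle n \<otimes> (strip n c \<otimes> triangle c) \<otimes> desc 0 (Suc c + n)"
    using Suc.IH by simp
  also have "\<dots> = triangle n \<otimes> (strip n c \<otimes> ((triangle c \<otimes> desc (Suc c) n) \<otimes> desc 0 (Suc c)))"
    unfolding split by (simp add: m_assoc del: desc.simps)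
  also have "triangle c \<otimes> desc (Suc c) n = desc (Suc c) n \<otimes> triangle c"
    by (simp add: triangle_desc_commute)
  finally show ?case
    by (simp add: m_assoc del: desc.simps)
qed simp

text \<open>\<open>s 1 \<otimes> strip 1 m\<close> is the increasing product of \<open>s 1\<close>
  to \<open>s (m + 1)\<close>, the mirror image of the run.\<close>

lemma desc_0_inverse: "desc 0 (Suc m) \<otimes> (s 1 \<otimes> strip 1 m) = \<one>"
proof (induction m)
  case (Suc m)
  have "desc 0 (Suc (Suc m)) \<otimes> (s 1 \<otimes> strip 1 (Suc m))
     = s (Suc (Suc m)) \<otimes> ((desc 0 (Suc m) \<otimes> (s 1 \<otimes> strip 1 m)) \<otimes> s (Suc (Suc m)))"
    by (simp add: m_assoc)
  then show ?case
    unfolding Suc.IH by (simp add: s_square)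
qed (simp add: s_square)

text \<open>Two factorizations of the same triangle are multiplied: the recursive one ends in a run,
  and the one from \<open>triangle_split\<close> with \<open>n = 1\<close> begins with the inverse
  of that run.\<close>

lemma triangle_square: "triangle m \<otimes> triangle m = \<one>"
proof (induction m)
  case (Suc m)
  have "triangle (Suc m) = (s 1 \<otimes> strip 1 m) \<otimes> triangle m"
    using triangle_split[of m 1] by (simp add: m_assoc)
  then have "triangle (Suc m) \<otimes> triangle (Suc m)
      = (triangle m \<otimes> desc 0 (Suc m)) \<otimes> ((s 1 \<otimes> strip 1 m) \<otimes> triangle m)"
    by (metis triangle.simps(2))
  also have "\<dots> = triangle m \<otimes> ((desc 0 (Suc m) \<otimes> (s 1 \<otimes> strip 1 m)) \<otimes> triangle m)"
    by (simp add: m_assoc del: desc.simps)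
  also have "\<dots> = \<one>"
    unfolding desc_0_inverse using Suc.IH by simp
  finally show ?case .
qed simp

text \<open>\<open>z\<close> is the product of the rows \<open>desc (c + 1) n\<close> to
  \<open>desc e n\<close>, whose indices are at least \<open>c + 2\<close>.\<close>

lemma strip_factor:
  assumes "c \<le> e"
  obtains z where "z \<in> carrier G" "strip n e = strip n c \<otimes> z" "z \<otimes> triangle c = triangle c \<otimes> z"
proof -
  have "\<exists>z\<in>carrier G. strip n e = strip n c \<otimes> z \<and> triangle c \<otimes> z = z \<otimes> triangle c"
    using assms
  proof (induction e rule: dec_induct)
    case base
    show ?case by (intro bexI[of _ \<one>]) auto
  next
    case (step e)
    then obtain z where z: "z \<in> carrier G" "strip n e = strip n c \<otimes> z"
      "triangle c \<otimes> z = z \<otimes> triangle c"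
      by blast
    have "triangle c \<otimes> (z \<otimes> desc (Suc e) n) = z \<otimes> desc (Suc e) n \<otimes> triangle c"
      by (rule commute_mult) (use z step.hyps triangle_desc_commute[of c "Suc e" n] in auto)
    then show ?case
      using z by (intro bexI[of _ "z \<otimes> desc (Suc e) n"]) (auto simp: m_assoc)
  qed
  then show ?thesis
    using that by metis
qed

text \<open>With \<open>n = b - c\<close> and \<open>e = a - b + c\<close> one has
  \<open>b = c + n\<close> and \<open>a = e + n\<close>, so \<open>triangle_split\<close> gives both
  triangles the common beginning \<open>triangle n \<otimes> strip n c\<close>, which cancels in
  \<open>?w\<close>.\<close>

sublocale triangle: prefix_reversals G triangle
proof
  fix a b c :: nat
  assume cb: "c \<le> b" and ba: "b \<le> a"
  let ?n = "b - c" and ?e = "a - b + c"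
  let ?w = "triangle b \<otimes> (triangle a \<otimes> triangle ?e)"
  note cancel = involution_cancel[OF _ _ triangle_square]
  obtain z where z: "z \<in> carrier G" "strip ?n ?e = strip ?n c \<otimes> z"
    "z \<otimes> triangle c = triangle c \<otimes> z"
    by (rule strip_factor[of c ?e ?n]) auto
  have "triangle a = triangle ?n \<otimes> (strip ?n ?e \<otimes> triangle ?e)"
    using triangle_split[of ?e ?n] cb ba by simp
  moreover have "triangle b = triangle ?n \<otimes> (strip ?n c \<otimes> triangle c)"
    using triangle_split[of c ?n] cb by simp
  then have "triangle b \<otimes> triangle c = triangle ?n \<otimes> strip ?n c"
    by (simp add: m_assoc triangle_square)
  ultimately have "triangle a = triangle b \<otimes> triangle c \<otimes> (z \<otimes> triangle ?e)"
    using z by (simp add: m_assoc)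
  then have "?w = triangle c \<otimes> z"
    using z(1) by (simp add: m_assoc cancel triangle_square)
  then have "?w \<otimes> triangle c = triangle c \<otimes> ?w"
    using z by (simp add: m_assoc)
  then have "triangle ?e \<otimes> (triangle a \<otimes> (triangle b \<otimes> (?w \<otimes> triangle c)))
      = triangle ?e \<otimes> (triangle a \<otimes> (triangle b \<otimes> (triangle c \<otimes> ?w)))"
    by simp
  \<comment> \<open>Commutation with \<open>?w\<close>, solved for \<open>triangle c\<close>.
    Inserted on the right of the goal, it works because \<open>?w \<otimes> triangle ?e\<close>
    collapses to \<open>triangle b \<otimes> triangle a\<close>.\<close>
  then have c: "triangle c = triangle ?e \<otimes> (triangle a \<otimes> (triangle b \<otimes> (triangle c \<otimes> ?w)))"
    by (simp add: m_assoc cancel)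
  show "triangle a \<otimes> (triangle b \<otimes> (triangle c \<otimes> (triangle b \<otimes> triangle a)))
      = triangle ?e \<otimes> (triangle c \<otimes> triangle ?e)"
    by (subst (2) c) (simp add: m_assoc cancel triangle_square)
qed (simp_all add: triangle_square)

text \<open>Consecutive triangles differ by a run, and consecutive runs by a single
  \<open>s i\<close>. This settles \<open>phi\<close> after \<open>psi\<close>.\<close>

lemma switch_triangle:
  assumes "1 \<le> i"
  shows "triangle.switch i = s i"
proof -
  consider "i = 1" | m where "i = m + 2"
    using assms by (metis One_nat_def add_2_eq_Suc' less_2_cases not_less le_Suc_ex add.commute not_one_le_zero)
  then show ?thesis
  proof cases
    case 2
    have d: "desc 0 (Suc k) = triangle k \<otimes> triangle (Suc k)" for k
      by (simp add: triangle.x_cancel del: desc.simps)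
    have "triangle.switch i = desc 0 (Suc (Suc m)) \<otimes> (triangle (Suc m) \<otimes> triangle m)"
      using 2 unfolding d by (simp add: triangle.switch_def m_assoc del: triangle.simps)
    also have "\<dots> = s i \<otimes> (desc 0 (Suc m) \<otimes> (triangle (Suc m) \<otimes> triangle m))"
      using 2 by (simp add: m_assoc)
    also have "\<dots> = s i"
      unfolding d by (simp add: m_assoc triangle.x_cancel triangle_square del: triangle.simps)
    finally show ?thesis .
  qed (simp add: triangle.switch_def)
qed

end

context prefix_reversals
begin

lemma commuting_involutions_switch: "commuting_involutions G switch"
  by unfold_locales (use switch_square switch_commute in auto)

interpretation switch: commuting_involutions G switch
  by (rule commuting_involutions_switch)

text \<open>The opposite telescoping, for \<open>psi\<close> after \<open>phi\<close>: a run of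
  switches collapses to \<open>x m \<otimes> x (Suc m)\<close>, and the product of these runs to a
  single \<open>x m\<close>.\<close>

lemma triangle_switch: "switch.triangle m = x m"
proof -
  have desc: "switch.desc 0 (Suc m) = x m \<otimes> x (Suc m)" for m
  proof (induction m)
    case 0
    show ?case by (simp add: switch.desc.simps) (simp add: switch_def x_0 x_square)
  next
    case (Suc m)
    then show ?case
      unfolding switch.desc.simps(2)[of 0 "Suc m"] Suc.IH
      by (simp add: switch_def m_assoc x_cancel x_square)
  qed
  show ?thesis
    by (induction m) (simp_all add: x_0 x_square desc x_cancel del: switch.desc.simps)
qed

end

section \<open>Homomorphisms out of a presented group\<close>

lemma (in group) normal_closure_normal:
  assumes "R \<subseteq> carrier G"
  shows "normal_closure G R \<lhd> G"
proof -
  let ?\<N> = "{N. N \<lhd> G \<and> R \<subseteq> N}"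
  \<comment> \<open>This makes the family nonempty, so that its intersection is a subgroup.\<close>
  have "carrier G \<in> ?\<N>"
    using assms subgroup_self by (simp add: normal_inv_iff)
  then have "subgroup (\<Inter>?\<N>) G"
    by (intro subgroups_Inter) (auto intro: normal_imp_subgroup)
  then show ?thesis
    unfolding normal_closure_def normal_inv_iff by (auto simp: normal_inv_iff)
qed

lemma subset_normal_closure: "R \<subseteq> normal_closure G R"
  by (auto simp: normal_closure_def)

lemma normal_closure_least: "N \<lhd> G \<Longrightarrow> R \<subseteq> N \<Longrightarrow> normal_closure G R \<subseteq> N"
  by (auto simp: normal_closure_def)

text \<open>Both maps are the free lift of their common values on generators.\<close>

lemma free_group_hom_eqI:
  assumes "group H" "h \<in> hom (free_group S) H" "k \<in> hom (free_group S) H"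
    and "\<And>x. x \<in> S \<Longrightarrow> h (gen x) = k (gen x)" "w \<in> carrier (free_group S)"
  shows "h w = k w"
  using group.free_lift_unique[OF assms(1,2) _ assms(5), of "\<lambda>x. k (gen x)"]
    group.free_lift_unique[OF assms(1,3) _ assms(5), of "\<lambda>x. k (gen x)"] assms(4) by simp

context
  fixes S :: "'a set" and E :: "('a word \<times> 'a word) set"
  assumes E: "E \<subseteq> carrier (free_group S) \<times> carrier (free_group S)"
begin

interpretation F: group "free_group S"
  by (rule free_group_is_group)

lemma relator_closure_normal: "relator_closure S E \<lhd> free_group S"
  unfolding relator_closure_def using E by (intro F.normal_closure_normal) auto

lemma group_presented_group: "group (presented_group S E)"
  unfolding presented_group_def by (rule normal.factorgroup_is_group[OF relator_closure_normal])

lemma presented_group_proj_hom: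
  "(\<lambda>w. relator_closure S E #>\<^bsub>free_group S\<^esub> w) \<in> hom (free_group S) (presented_group S E)"
  unfolding presented_group_def by (rule normal.r_coset_hom_Mod[OF relator_closure_normal])

lemma presented_group_relation:
  assumes "(u, v) \<in> E"
  shows "relator_closure S E #>\<^bsub>free_group S\<^esub> u = relator_closure S E #>\<^bsub>free_group S\<^esub> v"
proof -
  have uv: "u \<in> carrier (free_group S)" "v \<in> carrier (free_group S)"
    using assms E by auto
  have "u \<otimes>\<^bsub>free_group S\<^esub> inv\<^bsub>free_group S\<^esub> v \<in> relator_closure S E"
    unfolding relator_closure_def using assms by (intro subsetD[OF subset_normal_closure]) force
  then have "relator_closure S E #>\<^bsub>free_group S\<^esub> (u \<otimes>\<^bsub>free_group S\<^esub> inv\<^bsub>free_group S\<^esub> v)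
      = relator_closure S E"
    using uv F.coset_join2[OF _ normal_imp_subgroup[OF relator_closure_normal]] by simp
  then show ?thesis
    using uv F.coset_mult_inv1[of "relator_closure S E" u v]
      subgroup.subset[OF normal_imp_subgroup[OF relator_closure_normal]] by simp
qed

text \<open>Von Dyck's theorem: each \<open>u v^{-1}\<close> lies in the kernel of \<open>h\<close>,
  which is normal and therefore contains the relator closure.\<close>

lemma presented_group_universal:
  assumes "group H" "h \<in> hom (free_group S) H" and rel: "\<And>u v. (u, v) \<in> E \<Longrightarrow> h u = h v"
  obtains g where "g \<in> hom (presented_group S E) H"
    "\<And>w. w \<in> carrier (free_group S) \<Longrightarrow> g (relator_closure S E #>\<^bsub>free_group S\<^esub> w) = h w"
proof -
  interpret h: group_hom "free_group S" H h
    using assms(1,2) by (simp add: group_hom_def group_hom_axioms_def F.is_group)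
  have "u \<otimes>\<^bsub>free_group S\<^esub> inv\<^bsub>free_group S\<^esub> v \<in> kernel (free_group S) H h" if "(u, v) \<in> E" for u v
    using that E rel[OF that] by (auto simp: kernel_def)
  then have "relator_closure S E \<subseteq> kernel (free_group S) H h"
    unfolding relator_closure_def by (intro normal_closure_least h.normal_kernel) auto
  then show ?thesis
    using h.FactGroup_universal_kernel[OF relator_closure_normal] that
    unfolding presented_group_def by metis
qed

end

section \<open>The isomorphism\<close>

interpretation Ft: group Ft
  by (rule free_group_is_group)

interpretation Fq: group Fq
  by (rule free_group_is_group)

lemma t_closed: "1 \<le> i \<Longrightarrow> t i \<in> carrier Ft"
  by (simp add: gen_closed St_def)

lemma q_closed: "1 \<le> i \<Longrightarrow> i < j \<Longrightarrow> q i j \<in> carrier Fq"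
  by (simp add: gen_closed Sq_def)

lemma E1_closed: "E1 \<subseteq> carrier Ft \<times> carrier Ft"
  by (auto simp: E1_def t_closed)

lemma E2_closed: "E2 \<subseteq> carrier Fq \<times> carrier Fq"
  by (auto simp: E2_def q_closed)

lemma t_desc_closed [simp]: "t_desc m \<in> carrier Ft"
  by (induction m) (simp_all add: t_closed)

lemma qt_closed [simp]: "qt m \<in> carrier Ft"
  by (induction m) (simp_all add: t_closed)

lemma phi_hom: "phi \<in> hom Fq Ft"
  unfolding phi_def by (rule Ft.free_lift_hom) auto

lemma psi_hom: "psi \<in> hom Ft Fq"
  unfolding psi_def by (rule Fq.free_lift_hom) (auto simp: St_def q_closed)

abbreviation proj1 :: "nat word \<Rightarrow> nat word set" where
  "proj1 w \<equiv> relator_closure St E1 #>\<^bsub>Ft\<^esub> w"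

abbreviation proj2 :: "(nat \<times> nat) word \<Rightarrow> (nat \<times> nat) word set" where
  "proj2 w \<equiv> relator_closure Sq E2 #>\<^bsub>Fq\<^esub> w"

interpretation G1: group G1
  unfolding G1_def by (rule group_presented_group[OF E1_closed])

interpretation G2: group G2
  unfolding G2_def by (rule group_presented_group[OF E2_closed])

interpretation p1: group_hom Ft G1 proj1
  by unfold_locales (use presented_group_proj_hom[OF E1_closed] in \<open>simp add: G1_def\<close>)

interpretation p2: group_hom Fq G2 proj2
  by unfold_locales (use presented_group_proj_hom[OF E2_closed] in \<open>simp add: G2_def\<close>)

interpretation phi: group_hom Fq Ft phi
  by unfold_locales (rule phi_hom)

interpretation psi: group_hom Ft Fq psi
  by unfold_locales (rule psi_hom)

text \<open>There is no generator of index 0; the identity in its place satisfies the assumptions on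
  commuting involutions.\<close>

definition s1 :: "nat \<Rightarrow> nat word set" where
  "s1 i = (if i = 0 then \<one>\<^bsub>G1\<^esub> else proj1 (t i))"

interpretation s1: commuting_involutions G1 s1
proof
  show "s1 i \<in> carrier G1" for i
    by (simp add: s1_def t_closed)
  show "s1 i \<otimes>\<^bsub>G1\<^esub> s1 i = \<one>\<^bsub>G1\<^esub>" for i
  proof (cases "i = 0")
    case False
    then have "(t i \<otimes>\<^bsub>Ft\<^esub> t i, \<one>\<^bsub>Ft\<^esub>) \<in> E1"
      by (auto simp: E1_def)
    then show ?thesis
      using presented_group_relation[OF E1_closed] False
      by (simp add: s1_def t_closed flip: p1.hom_mult)
  qed (simp add: s1_def)
  show "s1 i \<otimes>\<^bsub>G1\<^esub> s1 j = s1 j \<otimes>\<^bsub>G1\<^esub> s1 i" if "Suc i < j" for i j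
  proof (cases "i = 0")
    case False
    then have "(t i \<otimes>\<^bsub>Ft\<^esub> t j, t j \<otimes>\<^bsub>Ft\<^esub> t i) \<in> E1"
      using that unfolding E1_def by (intro UnI2 CollectI exI[of _ i] exI[of _ j]) auto
    then show ?thesis
      using presented_group_relation[OF E1_closed] False that
      by (simp add: s1_def t_closed flip: p1.hom_mult)
  qed (use that in \<open>simp add: s1_def t_closed\<close>)
qed

definition x2 :: "nat \<Rightarrow> (nat \<times> nat) word set" where
  "x2 m = (if m = 0 then \<one>\<^bsub>G2\<^esub> else proj2 (q 1 (Suc m)))"

lemma proj2_q_square:
  assumes "1 \<le> i" "i < j"
  shows "proj2 (q i j) \<otimes>\<^bsub>G2\<^esub> proj2 (q i j) = \<one>\<^bsub>G2\<^esub>"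
proof -
  have "(q i j \<otimes>\<^bsub>Fq\<^esub> q i j, \<one>\<^bsub>Fq\<^esub>) \<in> E2"
    using assms by (auto simp: E2_def)
  then show ?thesis
    using presented_group_relation[OF E2_closed] assms
    by (simp add: q_closed flip: p2.hom_mult)
qed

lemma proj2_q_conj:
  assumes "1 \<le> i" "i \<le> k" "k < l" "l \<le> j"
  shows "proj2 (q i j) \<otimes>\<^bsub>G2\<^esub> proj2 (q k l) \<otimes>\<^bsub>G2\<^esub> proj2 (q i j)
    = proj2 (q (i + j - l) (i + j - k))"
proof -
  have "(q i j \<otimes>\<^bsub>Fq\<^esub> q k l \<otimes>\<^bsub>Fq\<^esub> q i j, q (i + j - l) (i + j - k)) \<in> E2"
    using assms by (auto simp: E2_def)
  then show ?thesis
    using presented_group_relation[OF E2_closed] assms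
    by (simp add: q_closed flip: p2.hom_mult)
qed

lemma x2_closed: "x2 m \<in> carrier G2"
  by (simp add: x2_def q_closed)

lemma x2_square: "x2 m \<otimes>\<^bsub>G2\<^esub> x2 m = \<one>\<^bsub>G2\<^esub>"
  by (simp add: x2_def proj2_q_square)

text \<open>The relation for \<open>[1, j]\<close> and \<open>[1, j-i+1]\<close>. It makes every
  generator of \<open>G2\<close> a word in the \<open>x2 m\<close>.\<close>

lemma x2_reversal:
  assumes "1 \<le> i" "i < j"
  shows "x2 (j - 1) \<otimes>\<^bsub>G2\<^esub> (x2 (j - i) \<otimes>\<^bsub>G2\<^esub> x2 (j - 1)) = proj2 (q i j)"
proof -
  have "x2 (j - 1) = proj2 (q 1 j)" "x2 (j - i) = proj2 (q 1 (Suc (j - i)))"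
    using assms by (auto simp: x2_def)
  then show ?thesis
    using proj2_q_conj[of 1 1 "Suc (j - i)" j] assms by (simp add: G2.m_assoc q_closed)
qed

interpretation x2: prefix_reversals G2 x2
proof
  fix a b c :: nat
  assume cb: "c \<le> b" and ba: "b \<le> a"
  show "x2 a \<otimes>\<^bsub>G2\<^esub> (x2 b \<otimes>\<^bsub>G2\<^esub> (x2 c \<otimes>\<^bsub>G2\<^esub> (x2 b \<otimes>\<^bsub>G2\<^esub> x2 a)))
      = x2 (a - b + c) \<otimes>\<^bsub>G2\<^esub> (x2 c \<otimes>\<^bsub>G2\<^esub> x2 (a - b + c))"
  \<comment> \<open>For \<open>c = 0\<close> the inner interval is a single point and has no
    generator. Otherwise the claim is the relation for \<open>[1, a+1]\<close> and
    \<open>[b-c+1, b+1]\<close>.\<close>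
  proof (cases "c = 0")
    case True
    then show ?thesis
      by (simp add: x2_def[of 0] x2_closed x2_square G2.involution_cancel)
  next
    case False
    have b: "x2 b \<otimes>\<^bsub>G2\<^esub> (x2 c \<otimes>\<^bsub>G2\<^esub> x2 b) = proj2 (q (b - c + 1) (b + 1))"
      using x2_reversal[of "b - c + 1" "b + 1"] cb False by simp
    have e: "x2 (a - b + c) \<otimes>\<^bsub>G2\<^esub> (x2 c \<otimes>\<^bsub>G2\<^esub> x2 (a - b + c))
        = proj2 (q (a - b + 1) (a - b + c + 1))"
      using x2_reversal[of "a - b + 1" "a - b + c + 1"] False by simp
    have "x2 a = proj2 (q 1 (a + 1))"
      using cb ba False by (simp add: x2_def)
    then have "x2 a \<otimes>\<^bsub>G2\<^esub> proj2 (q (b - c + 1) (b + 1)) \<otimes>\<^bsub>G2\<^esub> x2 a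
        = proj2 (q (a - b + 1) (a - b + c + 1))"
      using proj2_q_conj[of 1 "b - c + 1" "b + 1" "a + 1"] cb ba False
      by (simp add: Suc_diff_le)
    then show ?thesis
      unfolding e b[symmetric] by (simp add: G2.m_assoc x2_closed)
  qed
qed (simp_all add: x2_closed x2_square, simp add: x2_def)

interpretation s2: commuting_involutions G2 x2.switch
  by (rule x2.commuting_involutions_switch)

lemma proj1_qt: "proj1 (qt m) = s1.triangle m"
proof -
  have "proj1 (t_desc n) = s1.desc 0 n" for n
  proof (induction n)
    case (Suc n)
    moreover have "s1 (Suc n) = proj1 (t (Suc n))"
      by (simp add: s1_def)
    ultimately show ?case
      by (simp add: t_closed)
  qed simp
  then show ?thesis
    by (induction m) (simp_all del: t_desc.simps s1.desc.simps)
qed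

lemma phi_q: "phi (q i j) = qt (j - 1) \<otimes>\<^bsub>Ft\<^esub> qt (j - i) \<otimes>\<^bsub>Ft\<^esub> qt (j - 1)"
  unfolding phi_def by (subst Ft.free_lift_gen) auto

lemma proj1_phi_q: "proj1 (phi (q i j)) = s1.triangle.reversal i j"
  by (simp add: phi_q proj1_qt s1.triangle.reversal_def G1.m_assoc)

lemma proj2_psi_t:
  assumes "1 \<le> i"
  shows "proj2 (psi (t i)) = x2.switch i"
proof -
  have psi: "psi (t i) = (if i = 1 then q 1 2
     else if i = 2 then q 1 2 \<otimes>\<^bsub>Fq\<^esub> q 1 3 \<otimes>\<^bsub>Fq\<^esub> q 1 2
     else q 1 i \<otimes>\<^bsub>Fq\<^esub> q 1 (i + 1) \<otimes>\<^bsub>Fq\<^esub> q 1 i \<otimes>\<^bsub>Fq\<^esub> q 1 (i - 1))"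
    unfolding psi_def using assms by (subst Fq.free_lift_gen) (auto simp: q_closed)
  consider "i = 1" | "i = 2" | "i > 2"
    using assms by linarith
  then show ?thesis
    by cases (use psi in \<open>simp_all add: x2.switch_def x2_def q_closed G2.m_assoc
        numeral_2_eq_2 numeral_3_eq_3 Suc_diff_Suc\<close>)
qed

lemma proj2_psi_qt: "proj2 (psi (qt m)) = x2 m"
proof -
  have "proj2 (psi (t_desc n)) = s2.desc 0 n" for n
    by (induction n) (simp_all add: t_closed proj2_psi_t)
  then have "proj2 (psi (qt m)) = s2.triangle m"
    by (induction m) (simp_all del: t_desc.simps s2.desc.simps)
  then show ?thesis
    by (simp add: x2.triangle_switch)
qed

theorem theorem1p7:
  shows "G1 \<cong> G2 \<and>
    phi \<in> hom Fq Ft \<and> psi \<in> hom Ft Fq \<and>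
    (\<exists>\<Phi> \<Psi>.
       induced_by Fq (relator_closure Sq E2) Ft (relator_closure St E1) phi \<Phi> \<and>
       induced_by Ft (relator_closure St E1) Fq (relator_closure Sq E2) psi \<Psi> \<and>
       group_isomorphisms G2 G1 \<Phi> \<Psi>)"
proof -
  have hom1: "(\<lambda>w. proj1 (phi w)) \<in> hom Fq G1"
    using hom_compose[OF phi_hom p1.homh] by (simp add: comp_def)
  \<comment> \<open>The generators go to reversals built from triangles in \<open>G1\<close>, which
    satisfy both families of relations.\<close>
  have rel1: "proj1 (phi u) = proj1 (phi v)" if "(u, v) \<in> E2" for u v
    using that unfolding E2_def
    by (auto simp: q_closed proj1_phi_q s1.triangle.reversal_square s1.triangle.reversal_conj)
  obtain \<Phi> where \<Phi>: "\<Phi> \<in> hom G2 G1" "\<And>w. w \<in> carrier Fq \<Longrightarrow> \<Phi> (proj2 w) = proj1 (phi w)"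
    using presented_group_universal[OF E2_closed G1.is_group hom1 rel1] unfolding G2_def by metis
  have hom2: "(\<lambda>w. proj2 (psi w)) \<in> hom Ft G2"
    using hom_compose[OF psi_hom p2.homh] by (simp add: comp_def)
  have rel2: "proj2 (psi u) = proj2 (psi v)" if "(u, v) \<in> E1" for u v
  proof -
    consider i where "1 \<le> i" "u = t i \<otimes>\<^bsub>Ft\<^esub> t i" "v = \<one>\<^bsub>Ft\<^esub>"
      | i j where "1 \<le> i" "1 \<le> j" "Suc i < j \<or> Suc j < i"
        "u = t i \<otimes>\<^bsub>Ft\<^esub> t j" "v = t j \<otimes>\<^bsub>Ft\<^esub> t i"
      using \<open>(u, v) \<in> E1\<close> unfolding E1_def by fastforce
    then show ?thesis
    proof cases
      case 1
      then show ?thesis by (simp add: t_closed proj2_psi_t x2.switch_square)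
    next
      case 2
      then show ?thesis
        using x2.switch_commute[of i j] x2.switch_commute[of j i]
        by (auto simp: t_closed proj2_psi_t)
    qed
  qed
  obtain \<Psi> where \<Psi>: "\<Psi> \<in> hom G1 G2" "\<And>w. w \<in> carrier Ft \<Longrightarrow> \<Psi> (proj1 w) = proj2 (psi w)"
    using presented_group_universal[OF E1_closed G2.is_group hom2 rel2] unfolding G1_def by metis
  have 1: "proj1 (phi (psi w)) = proj1 w" if "w \<in> carrier Ft" for w
  proof (rule free_group_hom_eqI[OF G1.is_group _ p1.homh _ that])
    show "(\<lambda>w. proj1 (phi (psi w))) \<in> hom Ft G1"
      using hom_compose[OF psi_hom hom1] by (simp add: comp_def)
    show "proj1 (phi (psi (t i))) = proj1 (t i)" if "i \<in> St" for i
    proof -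
      have i: "1 \<le> i" using that by (simp add: St_def)
      \<comment> \<open>Hence \<open>\<Phi>\<close> takes switches in the \<open>x2 m\<close> to
        switches in the triangles, which are the \<open>s1 i\<close>. The case \<open>m = 0\<close>
        enters for \<open>i = 1\<close> and \<open>i = 2\<close>.\<close>
      have x: "\<Phi> (x2 m) = s1.triangle m" for m
      proof (cases "m = 0")
        case True
        then show ?thesis
          using \<Phi> hom_one[OF \<Phi>(1) G2.is_group G1.is_group] by (simp add: x2_def)
      next
        case False
        then show ?thesis
          using \<Phi>(2)[of "q 1 (Suc m)"] s1.triangle.reversal_1[of m]
          by (simp add: x2_def q_closed proj1_phi_q)
      qed
      have "proj1 (phi (psi (t i))) = \<Phi> (x2.switch i)"
        using \<Phi>(2)[of "psi (t i)"] i by (simp add: t_closed proj2_psi_t)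
      also have "\<dots> = s1.triangle.switch i"
        using \<Phi>(1) by (simp add: x2.switch_def s1.triangle.switch_def x2_closed hom_mult x)
      finally show ?thesis
        using i s1.switch_triangle[OF i] by (simp add: s1_def)
    qed
  qed
  have 2: "proj2 (psi (phi w)) = proj2 w" if "w \<in> carrier Fq" for w
  proof (rule free_group_hom_eqI[OF G2.is_group _ p2.homh _ that])
    show "(\<lambda>w. proj2 (psi (phi w))) \<in> hom Fq G2"
      using hom_compose[OF phi_hom hom2] by (simp add: comp_def)
    show "proj2 (psi (phi (gen p))) = proj2 (gen p)" if p: "p \<in> Sq" for p
    proof -
      obtain i j where ij: "p = (i, j)" "1 \<le> i" "i < j"
        using p by (auto simp: Sq_def)
      \<comment> \<open>Since \<open>psi (qt m)\<close> projects to \<open>x2 m\<close>, the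
        defining word of \<open>phi (q i j)\<close> becomes the left side of
        \<open>x2_reversal\<close>.\<close>
      then show ?thesis
        using x2_reversal[OF ij(2,3)] by (simp add: phi_q proj2_psi_qt G2.m_assoc x2_closed)
    qed
  qed
  \<comment> \<open>Every element of a quotient is the coset of a word, so the identities for words
    suffice.\<close>
  have "\<Psi> (\<Phi> y) = y" if "y \<in> carrier G2" for y
    using that 2 \<Phi>(2) \<Psi>(2) by (auto simp: G2_def presented_group_def carrier_FactGroup)
  moreover have "\<Phi> (\<Psi> y) = y" if "y \<in> carrier G1" for y
    using that 1 \<Phi>(2) \<Psi>(2) by (auto simp: G1_def presented_group_def carrier_FactGroup)
  ultimately have iso: "group_isomorphisms G2 G1 \<Phi> \<Psi>"
    using \<Phi>(1) \<Psi>(1) by (simp add: group_isomorphisms_def)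
  have "G1 \<cong> G2"
    using group_isomorphisms_imp_iso[OF group_isomorphisms_sym[OF iso]] by (auto simp: is_iso_def)
  then show ?thesis
    using phi_hom psi_hom iso \<Phi>(2) \<Psi>(2) unfolding induced_by_def by blast
qed

end
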